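(* Let $H=(X,Y)$ be a strongly biconvex graph (with respect to the given labeling $X=\{x_q,x_{q+1},\ldots,x_f\}$, $Y=\{y_{q'},y_{q'+1},\ldots,y_g\}$) with no isolated vertices. Then the set of edges $\mathcal{M}(H)=\{\{x_{i_\ell},y_{j_\ell}\} : \ell=1,\ldots,m\}$, produced by the greedy recursion described in the context, is a maximum induced matching of $H$, i.e. an induced matching of maximum size among all induced matchings of $H$.
   Context: All graphs are finite and simple. Let $H=(X,Y)$ be a bipartite graph with bipartition $X\cup Y$, where $X=\{x_q,x_{q+1},\ldots,x_f\}$ and $Y=\{y_{q'},y_{q'+1},\ldots,y_g\}$ for some $q,q'\ge 1$. $H$ is called strongly biconvex (with respect to this labeling) if: (1) if $\{x_i,y_j\}\in E(H)$, then $i<j$; and (2) for any $r$ with $i<r<j$ and $\{x_i,y_j\}\in E(H)$: (i) if $x_r\in X$, then $\{x_r,y_j\}\in E(H)$; (ii) if $y_r\in Y$, then $\{x_i,y_r\}\in E(H)$. $N_H(v)$ denotes the set of vertices adjacent to $v$. An induced matching of $H$ is a set of pairwise disjoint edges such that no endpoint of one of them is adjacent to an endpoint of another. Construction of $\mathcal{M}(H)$: put $i_1=q$ and $j_1=q'$. For $\ell\ge 2$ (as long as $i_{\ell-1},j_{\ell-1}$ have been defined) set $$T^{\ell}_X=\{t\in\{q,\ldots,f\} : t\ge j_{\ell-1},\ N_H(x_t)\not\subseteq N_H(x_{i_{\ell-1}})\}.$$ If $T^{\ell}_X\ne\emptyset$, set $i_\ell=\min T^{\ell}_X$, $T^{\ell}_Y=\{t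 : y_t\in N_H(x_{i_\ell})\setminus N_H(x_{i_{\ell-1}})\}$ and $j_\ell=\min T^{\ell}_Y$. Let $m$ be the biggest integer for which $T^{m}_X\neq\emptyset$ (with $m=1$ if $T^2_X=\emptyset$). *)

theory Defs
  imports Main
begin

text \<open>A graph is a vertex set \<open>V\<close> together with a set \<open>E\<close> of two-element subsets of \<open>V\<close>.\<close>

definition finite_simple_graph :: "'a set \<Rightarrow> 'a set set \<Rightarrow> bool" where
  "finite_simple_graph V E \<longleftrightarrow> finite V \<and> (\<forall>e\<in>E. e \<subseteq> V \<and> card e = 2)"

definition neighbourhood :: "'a set set \<Rightarrow> 'a \<Rightarrow> 'a set" where
  "neighbourhood E v = {u. {v, u} \<in> E}"

definition no_isolated_vertices :: "'a set \<Rightarrow> 'a set set \<Rightarrow> bool" where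
  "no_isolated_vertices V E \<longleftrightarrow> (\<forall>v\<in>V. neighbourhood E v \<noteq> {})"

definition bipartition :: "'a set \<Rightarrow> 'a set set \<Rightarrow> 'a set \<Rightarrow> 'a set \<Rightarrow> bool" where
  "bipartition V E X Y \<longleftrightarrow>
     V = X \<union> Y \<and> X \<inter> Y = {} \<and> (\<forall>e\<in>E. \<exists>u\<in>X. \<exists>v\<in>Y. e = {u, v})"

text \<open>
  The classes are \<open>X = {x q, \<dots>, x f}\<close> and \<open>Y = {y q', \<dots>, y g}\<close>, both nonempty.
  The total functions \<open>x\<close> and \<open>y\<close> are meaningful only on \<open>{q..f}\<close> and \<open>{q'..g}\<close>,
  so every condition on an index is relativised to these intervals.
\<close>

definition labelled_bipartite_graph ::
  "'a set \<Rightarrow> 'a set set \<Rightarrow> (nat \<Rightarrow> 'a) \<Rightarrow> nat \<Rightarrow> nat \<Rightarrow> (nat \<Rightarrow> 'a) \<Rightarrow> nat \<Rightarrow> nat \<Rightarrow> bool" where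
  "labelled_bipartite_graph V E x q f y q' g \<longleftrightarrow>
     finite_simple_graph V E \<and>
     1 \<le> q \<and> q \<le> f \<and> 1 \<le> q' \<and> q' \<le> g \<and>
     inj_on x {q..f} \<and> inj_on y {q'..g} \<and>
     bipartition V E (x ` {q..f}) (y ` {q'..g})"

definition strongly_biconvex ::
  "'a set \<Rightarrow> 'a set set \<Rightarrow> (nat \<Rightarrow> 'a) \<Rightarrow> nat \<Rightarrow> nat \<Rightarrow> (nat \<Rightarrow> 'a) \<Rightarrow> nat \<Rightarrow> nat \<Rightarrow> bool" where
  "strongly_biconvex V E x q f y q' g \<longleftrightarrow>
     labelled_bipartite_graph V E x q f y q' g \<and>
     (\<forall>i\<in>{q..f}. \<forall>j\<in>{q'..g}. {x i, y j} \<in> E \<longrightarrow>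
        i < j \<and>
        (\<forall>r. i < r \<and> r < j \<longrightarrow>
           (r \<in> {q..f} \<longrightarrow> {x r, y j} \<in> E) \<and>
           (r \<in> {q'..g} \<longrightarrow> {x i, y r} \<in> E)))"

definition induced_matching :: "'a set set \<Rightarrow> 'a set set \<Rightarrow> bool" where
  "induced_matching E M \<longleftrightarrow>
     M \<subseteq> E \<and>
     (\<forall>e\<in>M. \<forall>e'\<in>M. e \<noteq> e' \<longrightarrow> e \<inter> e' = {} \<and> (\<forall>u\<in>e. \<forall>v\<in>e'. {u, v} \<notin> E))"

definition maximum_induced_matching :: "'a set set \<Rightarrow> 'a set set \<Rightarrow> bool" where
  "maximum_induced_matching E M \<longleftrightarrow>
     induced_matching E M \<and> (\<forall>M'. induced_matching E M' \<longrightarrow> card M' \<le> card M)"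

definition TX_step ::
  "'a set set \<Rightarrow> (nat \<Rightarrow> 'a) \<Rightarrow> nat \<Rightarrow> nat \<Rightarrow> nat \<Rightarrow> nat \<Rightarrow> nat set" where
  "TX_step E x q f i j =
     {t \<in> {q..f}. j \<le> t \<and> \<not> neighbourhood E (x t) \<subseteq> neighbourhood E (x i)}"

definition TY_step ::
  "'a set set \<Rightarrow> (nat \<Rightarrow> 'a) \<Rightarrow> (nat \<Rightarrow> 'a) \<Rightarrow> nat \<Rightarrow> nat \<Rightarrow> nat \<Rightarrow> nat \<Rightarrow> nat set" where
  "TY_step E x y q' g i i' =
     {t \<in> {q'..g}. y t \<in> neighbourhood E (x i') - neighbourhood E (x i)}"

text \<open>
  \<open>greedy E x q f y q' g l\<close> is \<open>Some (i\<^sub>l, j\<^sub>l)\<close> if \<open>i\<^sub>l\<close> and \<open>j\<^sub>l\<close> are defined and \<open>None\<close>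
  otherwise; indices start at \<open>l = 1\<close>, so the value at \<open>0\<close> is \<open>None\<close>.
\<close>

fun greedy ::
  "'a set set \<Rightarrow> (nat \<Rightarrow> 'a) \<Rightarrow> nat \<Rightarrow> nat \<Rightarrow> (nat \<Rightarrow> 'a) \<Rightarrow> nat \<Rightarrow> nat \<Rightarrow> nat \<Rightarrow> (nat \<times> nat) option"
where
  "greedy E x q f y q' g 0 = None"
| "greedy E x q f y q' g (Suc 0) = Some (q, q')"
| "greedy E x q f y q' g (Suc (Suc k)) =
     (case greedy E x q f y q' g (Suc k) of
        None \<Rightarrow> None
      | Some (i, j) \<Rightarrow>
          if TX_step E x q f i j = {} then None
          else let i' = Min (TX_step E x q f i j)
               in Some (i', Min (TY_step E x y q' g i i')))"

text \<open>The set \<open>T\<^sub>X\<close> of stage \<open>l \<ge> 2\<close>, taken to be empty if the preceding stage is undefined.\<close>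

definition TX ::
  "'a set set \<Rightarrow> (nat \<Rightarrow> 'a) \<Rightarrow> nat \<Rightarrow> nat \<Rightarrow> (nat \<Rightarrow> 'a) \<Rightarrow> nat \<Rightarrow> nat \<Rightarrow> nat \<Rightarrow> nat set" where
  "TX E x q f y q' g l =
     (case greedy E x q f y q' g (l - 1) of
        None \<Rightarrow> {}
      | Some (i, j) \<Rightarrow> TX_step E x q f i j)"

definition greedy_length ::
  "'a set set \<Rightarrow> (nat \<Rightarrow> 'a) \<Rightarrow> nat \<Rightarrow> nat \<Rightarrow> (nat \<Rightarrow> 'a) \<Rightarrow> nat \<Rightarrow> nat \<Rightarrow> nat" where
  "greedy_length E x q f y q' g =
     (GREATEST l. l = 1 \<or> 2 \<le> l \<and> TX E x q f y q' g l \<noteq> {})"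

definition greedy_matching ::
  "'a set set \<Rightarrow> (nat \<Rightarrow> 'a) \<Rightarrow> nat \<Rightarrow> nat \<Rightarrow> (nat \<Rightarrow> 'a) \<Rightarrow> nat \<Rightarrow> nat \<Rightarrow> 'a set set" where
  "greedy_matching E x q f y q' g =
     (\<lambda>l. case the (greedy E x q f y q' g l) of (i, j) \<Rightarrow> {x i, y j})
       ` {1..greedy_length E x q f y q' g}"

end

theory Submission
  imports Defs
begin

text \<open>
  Call \<open>i\<close> and \<open>j\<close> adjacent if \<open>{x i, y j}\<close> is an edge, and let \<open>reach i\<close> be the largest
  \<open>j\<close> adjacent to \<open>i\<close>. Strong biconvexity says two things: the neighbours of \<open>i\<close> are exactly
  the labels \<open>j\<close> of \<open>Y\<close> with \<open>i < j \<le> reach i\<close> (\<open>adj_iff\<close>), and \<open>reach\<close> is monotone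
  (\<open>reach_mono\<close>). Hence two edges \<open>(a, b)\<close>, \<open>(a', b')\<close> with \<open>a < a'\<close> can occur
  together in an induced matching only if \<open>b \<le> a'\<close> and \<open>reach a < b'\<close>
  (\<open>independent_edges\<close>).

  In these terms the recursion takes for \<open>i'\<close> the first label \<open>t \<ge> j\<close> of \<open>X\<close> that reaches
  further than \<open>i\<close>, and for \<open>j'\<close> the first label of \<open>Y\<close> beyond both \<open>i'\<close> and \<open>reach i\<close>
  (\<open>greedy_step\<close>). So consecutive greedy edges are separated as above, and by transitivity
  any two of them are (\<open>greedy_separated\<close>): the greedy edges form an induced matching.

  For maximality, say that stage \<open>l\<close> precedes an edge \<open>(a, b)\<close> if \<open>i\<^sub>l \<le> a\<close> and
  \<open>j\<^sub>l \<le> b\<close>, and charge every edge of \<open>H\<close> to the last stage that precedes it; the first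
  stage \<open>(q, q')\<close> precedes every edge. If two independent edges with \<open>a < a'\<close> are both
  preceded by stage \<open>l\<close>, then \<open>a' \<ge> b \<ge> j\<^sub>l\<close> and \<open>reach a' \<ge> b' > reach a \<ge> reach i\<^sub>l\<close>,
  so the recursion does not stop at stage \<open>l\<close>, and minimality of its choices makes stage
  \<open>l + 1\<close> precede \<open>(a', b')\<close> (\<open>next_stage_precedes\<close>). Thus the edges of an induced matching
  are charged to different stages, and there are at most \<open>m\<close> of them.
\<close>

section \<open>Strongly biconvex graphs without isolated vertices\<close>

locale strongly_biconvex_graph =
  fixes V :: "'a set" and E :: "'a set set"
    and x y :: "nat \<Rightarrow> 'a" and q f q' g :: nat
  assumes biconvex: "strongly_biconvex V E x q f y q' g"
    and no_isolated: "no_isolated_vertices V E"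
begin

definition adj :: "nat \<Rightarrow> nat \<Rightarrow> bool" where
  "adj i j \<longleftrightarrow> i \<in> {q..f} \<and> j \<in> {q'..g} \<and> {x i, y j} \<in> E"

definition reach :: "nat \<Rightarrow> nat" where
  "reach i = Max {j. adj i j}"

lemma labelled: "labelled_bipartite_graph V E x q f y q' g"
  using biconvex unfolding strongly_biconvex_def by blast

lemma bounds: "1 \<le> q" "q \<le> f" "1 \<le> q'" "q' \<le> g"
  and inj_x: "inj_on x {q..f}" and inj_y: "inj_on y {q'..g}"
  and bipart: "bipartition V E (x ` {q..f}) (y ` {q'..g})"
  using labelled unfolding labelled_bipartite_graph_def by blast+

lemma x_neq_y: "i \<in> {q..f} \<Longrightarrow> j \<in> {q'..g} \<Longrightarrow> x i \<noteq> y j"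
  using bipart unfolding bipartition_def by blast

lemma edge_adj: assumes "e \<in> E" obtains i j where "adj i j" "e = {x i, y j}"
proof -
  obtain u v where "u \<in> x ` {q..f}" "v \<in> y ` {q'..g}" "e = {u, v}"
    using bipart assms unfolding bipartition_def by metis
  then show thesis using assms that unfolding adj_def by blast
qed

lemma no_edge_within_x:
  assumes "i \<in> {q..f}" "i' \<in> {q..f}"
  shows "{x i, x i'} \<notin> E"
proof
  assume "{x i, x i'} \<in> E"
  then obtain k j where "adj k j" "{x i, x i'} = {x k, y j}" by (rule edge_adj)
  then show False using x_neq_y assms by (auto simp: adj_def doubleton_eq_iff)
qed

lemma no_edge_within_y:
  assumes "j \<in> {q'..g}" "j' \<in> {q'..g}"
  shows "{y j, y j'} \<notin> E"
proof
  assume "{y j, y j'} \<in> E"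
  then obtain i k where "adj i k" "{y j, y j'} = {x i, y k}" by (rule edge_adj)
  then show False
    using x_neq_y[of i j] x_neq_y[of i j'] assms by (auto simp: adj_def doubleton_eq_iff)
qed

lemma adj_range: "adj i j \<Longrightarrow> i \<in> {q..f} \<and> j \<in> {q'..g}"
  by (simp add: adj_def)

lemma adj_less: "adj i j \<Longrightarrow> i < j"
  using biconvex unfolding strongly_biconvex_def adj_def by blast

lemma adj_closer_x: "adj i j \<Longrightarrow> i < r \<Longrightarrow> r < j \<Longrightarrow> r \<in> {q..f} \<Longrightarrow> adj r j"
  using biconvex unfolding strongly_biconvex_def adj_def by blast

lemma adj_closer_y: "adj i j \<Longrightarrow> i < r \<Longrightarrow> r < j \<Longrightarrow> r \<in> {q'..g} \<Longrightarrow> adj i r"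
  using biconvex unfolding strongly_biconvex_def adj_def by blast

lemma neighbourhood_x:
  assumes "i \<in> {q..f}"
  shows "neighbourhood E (x i) = y ` {j. adj i j}"
proof (intro equalityI subsetI)
  fix u assume "u \<in> neighbourhood E (x i)"
  then have "{x i, u} \<in> E" by (simp add: neighbourhood_def)
  then obtain i' j where *: "adj i' j" "{x i, u} = {x i', y j}" by (rule edge_adj)
  then have "x i = x i'" "u = y j"
    using x_neq_y assms adj_range by (metis doubleton_eq_iff)+
  moreover have "i = i'" using \<open>x i = x i'\<close> inj_x assms adj_range[OF *(1)] by (meson inj_onD)
  ultimately show "u \<in> y ` {j. adj i j}" using * by blast
qed (auto simp: neighbourhood_def adj_def)

lemma y_in_neighbourhood_x:
  assumes "i \<in> {q..f}" "j \<in> {q'..g}"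
  shows "y j \<in> neighbourhood E (x i) \<longleftrightarrow> adj i j"
  using assms by (simp add: neighbourhood_def adj_def)

lemma x_has_neighbour: assumes "i \<in> {q..f}" obtains j where "adj i j"
proof -
  have "x i \<in> V" using bipart assms unfolding bipartition_def by blast
  then have "neighbourhood E (x i) \<noteq> {}"
    using no_isolated unfolding no_isolated_vertices_def by blast
  then show thesis using that neighbourhood_x[OF assms] by blast
qed

lemma y_has_neighbour: assumes "j \<in> {q'..g}" obtains i where "adj i j"
proof -
  have "y j \<in> V" using bipart assms unfolding bipartition_def by blast
  then obtain u where "{y j, u} \<in> E"
    using no_isolated unfolding no_isolated_vertices_def neighbourhood_def by blast
  then obtain i j' where *: "adj i j'" "{y j, u} = {x i, y j'}" by (rule edge_adj)
  then have "y j = y j'" using x_neq_y assms adj_range by (metis doubleton_eq_iff)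
  then have "j = j'" using inj_y assms adj_range[OF *(1)] by (meson inj_onD)
  then show thesis using that * by blast
qed

section \<open>Neighbourhoods as intervals\<close>

lemma finite_adj: "finite {j. adj i j}"
  by (rule finite_subset[of _ "{q'..g}"]) (auto simp: adj_def)

lemma adj_reach: assumes "i \<in> {q..f}" shows "adj i (reach i)"
proof -
  have "{j. adj i j} \<noteq> {}" using x_has_neighbour[OF assms] by blast
  from Max_in[OF finite_adj this] show ?thesis by (simp add: reach_def)
qed

lemma adj_iff: "adj i j \<longleftrightarrow> i \<in> {q..f} \<and> j \<in> {q'..g} \<and> i < j \<and> j \<le> reach i"
proof
  assume "adj i j"
  then show "i \<in> {q..f} \<and> j \<in> {q'..g} \<and> i < j \<and> j \<le> reach i"
    using adj_range adj_less Max_ge[OF finite_adj] unfolding reach_def by blast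
next
  assume "i \<in> {q..f} \<and> j \<in> {q'..g} \<and> i < j \<and> j \<le> reach i"
  then show "adj i j" using adj_closer_y[OF adj_reach] adj_reach by (metis le_neq_implies_less)
qed

lemma less_reach: "i \<in> {q..f} \<Longrightarrow> i < reach i"
  using adj_reach adj_less by blast

text \<open>Either \<open>reach i\<close> is still to the right of \<open>i'\<close> and then adjacent to \<open>i'\<close> by convexity,
  or \<open>reach i \<le> i' < reach i'\<close>.\<close>

lemma reach_mono:
  assumes "i \<in> {q..f}" "i' \<in> {q..f}" "i \<le> i'"
  shows "reach i \<le> reach i'"
proof (cases "reach i \<le> i' \<or> i = i'")
  case True
  then show ?thesis using less_reach[OF assms(2)] by auto
next
  case False
  then have "adj i' (reach i)"
    using adj_closer_x[OF adj_reach[OF assms(1)]] assms by simp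
  then show ?thesis by (simp add: adj_iff)
qed

text \<open>Since \<open>b \<le> reach a \<le> reach a'\<close>, the only way for \<open>b\<close> to avoid \<open>a'\<close> is to be at most
  \<open>a'\<close>; then \<open>a < b'\<close>, and \<open>b'\<close> can avoid \<open>a\<close> only beyond \<open>reach a\<close>.\<close>

lemma independent_edges:
  assumes "adj a b" "adj a' b'" "\<not> adj a' b" "\<not> adj a b'" "a < a'"
  shows "b \<le> a' \<and> reach a < b'"
proof -
  have "reach a \<le> reach a'" using assms reach_mono by (simp add: adj_iff)
  then show ?thesis using assms by (auto simp: adj_iff)
qed

text \<open>The vertex \<open>y q'\<close> has a neighbour, hence \<open>q < q'\<close>; and \<open>q'\<close> is the
  smallest label of \<open>Y\<close>, so it lies in the interval from \<open>q + 1\<close> to \<open>reach q\<close>.\<close>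

lemma adj_first: "adj q q'"
proof -
  obtain i where "adj i q'" using y_has_neighbour[of q'] bounds by auto
  then have "q < q'" by (auto simp: adj_iff)
  moreover have "q' \<le> reach q" using adj_reach[of q] bounds by (simp add: adj_iff)
  ultimately show ?thesis using bounds by (simp add: adj_iff)
qed

section \<open>The greedy recursion\<close>

text \<open>The neighbourhoods of \<open>x t\<close> and \<open>x i\<close> are intervals of \<open>Y\<close>. Since \<open>t \<ge> j > i\<close>, the one
  of \<open>x t\<close> starts no earlier, so only their right ends decide about inclusion.\<close>

lemma TX_step_eq:
  assumes "adj i j"
  shows "TX_step E x q f i j = {t \<in> {q..f}. j \<le> t \<and> reach i < reach t}"
proof -
  have i: "i \<in> {q..f}" and "i < j" using assms by (simp_all add: adj_iff)
  have "\<not> neighbourhood E (x t) \<subseteq> neighbourhood E (x i) \<longleftrightarrow> reach i < reach t"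
    if t: "t \<in> {q..f}" "j \<le> t" for t
  proof
    assume "\<not> neighbourhood E (x t) \<subseteq> neighbourhood E (x i)"
    then obtain b where "adj t b" "\<not> adj i b"
      using neighbourhood_x[OF t(1)] neighbourhood_x[OF i] by blast
    then show "reach i < reach t" using i \<open>i < j\<close> t by (auto simp: adj_iff)
  next
    assume "reach i < reach t"
    then have "adj t (reach t)" "\<not> adj i (reach t)"
      using adj_reach[OF t(1)] by (auto simp: adj_iff)
    then show "\<not> neighbourhood E (x t) \<subseteq> neighbourhood E (x i)"
      using y_in_neighbourhood_x t(1) i adj_range by blast
  qed
  then show ?thesis unfolding TX_step_def by blast
qed

lemma TY_step_eq:
  assumes "i \<in> {q..f}" "i' \<in> {q..f}" "i \<le> i'"
  shows "TY_step E x y q' g i i' = {b \<in> {q'..g}. i' < b \<and> reach i < b \<and> b \<le> reach i'}"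
proof -
  have "y b \<in> neighbourhood E (x i') - neighbourhood E (x i) \<longleftrightarrow>
      i' < b \<and> reach i < b \<and> b \<le> reach i'" if "b \<in> {q'..g}" for b
    using that assms by (auto simp: y_in_neighbourhood_x adj_iff)
  then show ?thesis unfolding TY_step_def by blast
qed

abbreviation stage :: "nat \<Rightarrow> (nat \<times> nat) option" where
  "stage \<equiv> greedy E x q f y q' g"

text \<open>The minimality of \<open>j'\<close> holds without an upper bound on the competitor \<open>b\<close>: a label beyond
  \<open>reach i'\<close> is larger than \<open>j'\<close> anyway.\<close>

lemma greedy_step:
  assumes "stage (Suc k) = Some (i, j)" "stage (Suc (Suc k)) = Some (i', j')" "adj i j"
  shows "adj i' j'" "j \<le> i'" "reach i < j'"
    and "\<And>t. t \<in> {q..f} \<Longrightarrow> j \<le> t \<Longrightarrow> reach i < reach t \<Longrightarrow> i' \<le> t"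
    and "\<And>b. b \<in> {q'..g} \<Longrightarrow> i' < b \<Longrightarrow> reach i < b \<Longrightarrow> j' \<le> b"
proof -
  let ?T = "TX_step E x q f i j"
  let ?S = "TY_step E x y q' g i i'"
  have ne: "?T \<noteq> {}" and i': "i' = Min ?T" and j': "j' = Min ?S"
    using assms by (auto simp: Let_def split: if_splits)
  have "finite ?T" by (simp add: TX_step_def)
  then have "i' \<in> ?T" using ne i' Min_in by blast
  then have i'T: "i' \<in> {q..f}" "j \<le> i'" "reach i < reach i'"
    by (simp_all add: TX_step_eq[OF assms(3)])
  have i: "i \<in> {q..f}" "i \<le> i'" using assms(3) i'T by (auto simp: adj_iff)
  note S = TY_step_eq[OF i(1) i'T(1) i(2)]
  have "reach i' \<in> ?S" using adj_reach[OF i'T(1)] i'T by (simp add: S adj_iff)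
  moreover have fin: "finite ?S" by (simp add: TY_step_def)
  ultimately have "j' \<in> ?S" using j' Min_in by blast
  then have j'S: "j' \<in> {q'..g}" "i' < j'" "reach i < j'" "j' \<le> reach i'"
    by (simp_all add: S)
  show "adj i' j'" using j'S i'T by (simp add: adj_iff)
  show "j \<le> i'" "reach i < j'" by fact+
  show "i' \<le> t" if "t \<in> {q..f}" "j \<le> t" "reach i < reach t" for t
    using that i' Min_le[OF \<open>finite ?T\<close>] by (simp add: TX_step_eq[OF assms(3)])
  show "j' \<le> b" if b: "b \<in> {q'..g}" "i' < b" "reach i < b" for b
  proof (cases "b \<le> reach i'")
    case True
    then have "b \<in> ?S" using b by (simp add: S)
    then show ?thesis using j' fin Min_le by blast
  qed (use j'S in simp)
qed

lemma greedy_pred: "stage (Suc (Suc k)) \<noteq> None \<Longrightarrow> stage (Suc k) \<noteq> None"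
  by (cases "stage (Suc k)") auto

lemma greedy_defined_mono:
  assumes "stage k \<noteq> None" "1 \<le> l" "l \<le> k"
  shows "stage l \<noteq> None"
  using assms(3,1)
proof (induction k rule: dec_induct)
  case (step n)
  then show ?case using assms(2) greedy_pred by (cases n) (auto simp del: greedy.simps(3))
qed

lemma greedy_adj: "stage k = Some (i, j) \<Longrightarrow> adj i j"
proof (induction k arbitrary: i j)
  case (Suc k)
  show ?case
  proof (cases k)
    case 0
    then show ?thesis using Suc.prems adj_first by simp
  next
    case (Suc l)
    then obtain i0 j0 where "stage (Suc l) = Some (i0, j0)"
      using greedy_pred Suc.prems by (metis not_None_eq surj_pair)
    then show ?thesis using greedy_step(1) Suc Suc.IH Suc.prems by blast
  qed
qed simp

text \<open>The separation of consecutive stages propagates along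
  \<open>j \<le> i' < j' \<le> i''\<close> and \<open>reach i < j' \<le> i'' < j''\<close>.\<close>

lemma greedy_separated:
  assumes "stage l = Some (i, j)" "stage k = Some (i', j')" "l < k"
  shows "j \<le> i' \<and> reach i < j'"
  using Suc_leI[OF assms(3)] assms(2)
proof (induction k arbitrary: i' j' rule: dec_induct)
  case base
  obtain n where "l = Suc n" using assms(1) by (cases l) auto
  then show ?case using greedy_step(2,3) greedy_adj assms(1) base by blast
next
  case (step n)
  then obtain p where n: "n = Suc p" by (cases n) auto
  then obtain i1 j1 where *: "stage n = Some (i1, j1)"
    using greedy_pred step.prems by (metis not_None_eq surj_pair)
  then have "j \<le> i1 \<and> reach i < j1" by (rule step)
  moreover have "j1 \<le> i'"
    using greedy_step(2) greedy_adj * step.prems n by blast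
  ultimately show ?case
    using greedy_adj[OF *] greedy_adj[OF step.prems] by (auto simp: adj_iff)
qed

lemma greedy_index_le: "stage k = Some (i, j) \<Longrightarrow> k \<le> j"
proof (induction k arbitrary: i j)
  case (Suc k)
  show ?case
  proof (cases "k = 0")
    case True
    then show ?thesis using greedy_adj[OF Suc.prems] by (simp add: adj_iff)
  next
    case False
    then obtain i0 j0 where *: "stage k = Some (i0, j0)"
      using greedy_defined_mono[of "Suc k" k] Suc.prems by auto
    then have "j0 \<le> i" using greedy_separated[OF * Suc.prems] by simp
    then show ?thesis using Suc.IH[OF *] greedy_adj[OF Suc.prems] by (simp add: adj_iff)
  qed
qed simp

abbreviation m :: nat where
  "m \<equiv> greedy_length E x q f y q' g"

text \<open>Stage \<open>l \<ge> 2\<close> is defined iff its set \<open>T\<^sub>X\<close> is nonempty, so \<open>m\<close> is the largest index of a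
  defined stage. It exists because the labels \<open>j\<^sub>l \<le> g\<close> grow strictly.\<close>

lemma stage_defined_iff: "stage l \<noteq> None \<longleftrightarrow> 1 \<le> l \<and> l \<le> m"
proof -
  have TX: "l = 1 \<or> 2 \<le> l \<and> TX E x q f y q' g l \<noteq> {} \<longleftrightarrow> stage l \<noteq> None" for l
  proof -
    consider "l = 0" | "l = 1" | k where "l = Suc (Suc k)" by (metis One_nat_def not0_implies_Suc)
    then show ?thesis
      by cases (auto simp: TX_def Let_def split: option.splits)
  qed
  have m: "m = (GREATEST l. stage l \<noteq> None)"
    unfolding greedy_length_def TX ..
  have bound: "l \<le> g" if def: "stage l \<noteq> None" for l
  proof -
    obtain i j where s: "stage l = Some (i, j)" using def by auto
    show ?thesis using greedy_index_le[OF s] greedy_adj[OF s] by (simp add: adj_iff)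
  qed
  have "stage 1 \<noteq> None" by simp
  then have "stage m \<noteq> None"
    unfolding m by (rule GreatestI_nat) (use bound in blast)
  moreover have "l \<le> m" if "stage l \<noteq> None" for l
    unfolding m by (rule Greatest_le_nat) (use that bound in blast)+
  moreover have "1 \<le> l" if "stage l \<noteq> None" using that by (cases l) auto
  ultimately show ?thesis using greedy_defined_mono by blast
qed

abbreviation stage_edge :: "nat \<Rightarrow> 'a set" where
  "stage_edge l \<equiv> case the (stage l) of (i, j) \<Rightarrow> {x i, y j}"

text \<open>For \<open>(i, j)\<close> at stage \<open>l\<close> and \<open>(i', j')\<close> at stage \<open>k\<close>, the label \<open>j \<le> i'\<close> is too small
  to be adjacent to \<open>i'\<close>, and \<open>j' > reach i\<close> is too large to be adjacent to \<open>i\<close>; edges inside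
  a colour class are excluded by bipartiteness.\<close>

lemma stage_edges_independent:
  assumes "l < k" "k \<le> m" "1 \<le> l"
  shows "stage_edge l \<inter> stage_edge k = {}"
    and "\<forall>u\<in>stage_edge l. \<forall>v\<in>stage_edge k. {u, v} \<notin> E"
proof -
  obtain i j where l: "stage l = Some (i, j)" using stage_defined_iff[of l] assms by auto
  obtain i' j' where k: "stage k = Some (i', j')" using stage_defined_iff[of k] assms by auto
  have sep: "j \<le> i'" "reach i < j'" using greedy_separated[OF l k assms(1)] by auto
  have a: "adj i j" "adj i' j'" using greedy_adj l k by auto
  have r: "i \<in> {q..f}" "i' \<in> {q..f}" "j \<in> {q'..g}" "j' \<in> {q'..g}"
    using a adj_range by auto
  have "i < i'" "j < j'" using sep a by (auto simp: adj_iff)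
  then have "x i \<noteq> x i'" "y j \<noteq> y j'" using inj_x inj_y r by (auto dest: inj_onD)
  moreover have "x i \<noteq> y j'" "x i' \<noteq> y j" using x_neq_y r by blast+
  ultimately show "stage_edge l \<inter> stage_edge k = {}" using l k by auto
  have "\<not> adj i j'" "\<not> adj i' j" using sep by (auto simp: adj_iff)
  then have "{x i, y j'} \<notin> E" "{y j, x i'} \<notin> E"
    using r by (simp_all add: adj_def insert_commute)
  moreover have "{x i, x i'} \<notin> E" "{y j, y j'} \<notin> E"
    using no_edge_within_x no_edge_within_y r by blast+
  ultimately show "\<forall>u\<in>stage_edge l. \<forall>v\<in>stage_edge k. {u, v} \<notin> E"
    using l k by simp
qed

lemma stage_edge_in_E:
  assumes "1 \<le> l" "l \<le> m" shows "stage_edge l \<in> E" "stage_edge l \<noteq> {}"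
proof -
  obtain i j where l: "stage l = Some (i, j)" using stage_defined_iff[of l] assms by auto
  then show "stage_edge l \<in> E" "stage_edge l \<noteq> {}"
    using greedy_adj[OF l] by (simp_all add: adj_def)
qed

lemma induced_matching_greedy: "induced_matching E (greedy_matching E x q f y q' g)"
  unfolding induced_matching_def greedy_matching_def
proof (intro conjI ballI impI subsetI)
  fix e assume "e \<in> stage_edge ` {1..m}"
  then show "e \<in> E" using stage_edge_in_E by auto
next
  fix e e' assume e: "e \<in> stage_edge ` {1..m}" "e' \<in> stage_edge ` {1..m}" "e \<noteq> e'"
  from e(1) obtain l where l: "e = stage_edge l" "l \<in> {1..m}" by (rule imageE)
  from e(2) obtain k where k: "e' = stage_edge k" "k \<in> {1..m}" by (rule imageE)
  have lk: "e = stage_edge l" "e' = stage_edge k" "l \<noteq> k"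
      "1 \<le> l" "l \<le> m" "1 \<le> k" "k \<le> m"
    using l k e(3) by auto
  from \<open>l \<noteq> k\<close> consider "l < k" | "k < l" by linarith
  then have *: "e \<inter> e' = {} \<and> (\<forall>u\<in>e. \<forall>v\<in>e'. {u, v} \<notin> E)"
  proof cases
    case 1
    then show ?thesis using stage_edges_independent[of l k] lk by simp
  next
    case 2
    then have "e' \<inter> e = {}" "\<forall>u\<in>e'. \<forall>v\<in>e. {u, v} \<notin> E"
      using stage_edges_independent[of k l] lk by simp_all
    then show ?thesis by (metis Int_commute insert_commute)
  qed
  then show "e \<inter> e' = {}" by blast
  show "{u, v} \<notin> E" if "u \<in> e" "v \<in> e'" for u v using * that by blast
qed

lemma card_greedy: "card (greedy_matching E x q f y q' g) = m"
proof -
  have "inj_on stage_edge {1..m}"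
  proof (rule linorder_inj_onI)
    fix l k assume "l < k" "l \<in> {1..m}" "k \<in> {1..m}"
    then have "stage_edge l \<inter> stage_edge k = {}" "stage_edge l \<noteq> {}"
      by (intro stage_edges_independent(1) stage_edge_in_E(2); simp)+
    then show "stage_edge l \<noteq> stage_edge k" by (metis Int_absorb)
  qed (rule linear)
  from card_image[OF this] show ?thesis unfolding greedy_matching_def by simp
qed

section \<open>Maximality\<close>

definition precedes :: "nat \<Rightarrow> nat \<Rightarrow> nat \<Rightarrow> bool" where
  "precedes l a b \<longleftrightarrow> (\<exists>i j. stage l = Some (i, j) \<and> i \<le> a \<and> j \<le> b)"

definition charge :: "nat \<Rightarrow> nat \<Rightarrow> nat" where
  "charge a b = (GREATEST l. precedes l a b)"

lemma precedes_le: "precedes l a b \<Longrightarrow> 1 \<le> l \<and> l \<le> m"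
  using stage_defined_iff unfolding precedes_def by (metis option.distinct(1))

lemma precedes_le_charge: "precedes l a b \<Longrightarrow> l \<le> charge a b"
  unfolding charge_def by (rule Greatest_le_nat) (use precedes_le in blast)+

lemma charge_precedes: assumes "adj a b" shows "precedes (charge a b) a b"
proof -
  have "precedes 1 a b" using assms by (simp add: precedes_def adj_def)
  then show ?thesis
    unfolding charge_def by (rule GreatestI_nat) (use precedes_le in blast)
qed

text \<open>The label \<open>a'\<close> is a candidate for \<open>i\<^bsub>l+1\<^esub>\<close>, since \<open>j\<^sub>l \<le> b \<le> a'\<close> and
  \<open>reach i\<^sub>l \<le> reach a < b' \<le> reach a'\<close>; so \<open>i\<^bsub>l+1\<^esub> \<le> a' < b'\<close>, and then \<open>b'\<close> competes with
  \<open>j\<^bsub>l+1\<^esub>\<close>.\<close>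

lemma next_stage_precedes:
  assumes "precedes l a b" "adj a b" "adj a' b'" "b \<le> a'" "reach a < b'"
  shows "precedes (Suc l) a' b'"
proof -
  obtain i j where l: "stage l = Some (i, j)" "i \<le> a" "j \<le> b"
    using assms(1) unfolding precedes_def by blast
  then obtain k where k: "l = Suc k" by (cases l) auto
  have adj: "adj i j" using greedy_adj l by blast
  then have "reach i \<le> reach a" using reach_mono l assms(2) by (simp add: adj_iff)
  then have *: "a' \<in> {q..f}" "j \<le> a'" "reach i < reach a'" "reach i < b'"
    using assms l by (auto simp: adj_iff)
  then have "TX_step E x q f i j \<noteq> {}" unfolding TX_step_eq[OF adj] by blast
  then obtain i' j' where s: "stage (Suc l) = Some (i', j')" using l k by (simp add: Let_def)
  note step = greedy_step[OF l(1)[unfolded k] s[unfolded k] adj]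
  have "i' \<le> a'" using step(4) * by blast
  moreover have "j' \<le> b'" using step(5) * assms(3) \<open>i' \<le> a'\<close> by (simp add: adj_iff)
  ultimately show ?thesis using s unfolding precedes_def by blast
qed

lemma charge_less:
  assumes "adj a b" "adj a' b'" "\<not> adj a' b" "\<not> adj a b'" "a < a'"
  shows "charge a b < charge a' b'"
proof -
  have "precedes (Suc (charge a b)) a' b'"
    using next_stage_precedes[OF charge_precedes] independent_edges assms by blast
  then show ?thesis using precedes_le_charge by fastforce
qed

lemma induced_matching_not_adj:
  assumes M: "induced_matching E M" "{x a, y b} \<in> M" "{x a', y b'} \<in> M"
    and ab: "adj a b" "adj a' b'" "(a, b) \<noteq> (a', b')"
  shows "a \<noteq> a' \<and> \<not> adj a b' \<and> \<not> adj a' b"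
proof -
  have r: "a \<in> {q..f}" "a' \<in> {q..f}" "b \<in> {q'..g}" "b' \<in> {q'..g}"
    using ab adj_range by auto
  have "{x a, y b} \<noteq> {x a', y b'}"
  proof
    assume "{x a, y b} = {x a', y b'}"
    moreover have "x a \<noteq> y b'" using x_neq_y r by blast
    ultimately have "x a = x a'" "y b = y b'" by (auto simp: doubleton_eq_iff)
    then show False using ab(3) inj_onD[OF inj_x _ r(1,2)] inj_onD[OF inj_y _ r(3,4)] by simp
  qed
  then have "{x a, y b} \<inter> {x a', y b'} = {} \<and>
      (\<forall>u\<in>{x a, y b}. \<forall>v\<in>{x a', y b'}. {u, v} \<notin> E)"
    using M unfolding induced_matching_def by meson
  then have "x a' \<noteq> x a" "{x a, y b'} \<notin> E" "{x a', y b} \<notin> E"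
    by (simp_all add: insert_commute)
  then show ?thesis by (auto simp: adj_def)
qed

lemma card_induced_matching_le:
  assumes M: "induced_matching E M"
  shows "card M \<le> m"
proof -
  \<comment> \<open>Charges depend on labels, so the label pairs of the edges in \<open>M\<close> are counted.\<close>
  let ?P = "{(a, b). adj a b \<and> {x a, y b} \<in> M}"
  have "M \<subseteq> (\<lambda>(a, b). {x a, y b}) ` ?P"
  proof
    fix e assume e: "e \<in> M"
    then have "e \<in> E" using M unfolding induced_matching_def by blast
    then show "e \<in> (\<lambda>(a, b). {x a, y b}) ` ?P" using e by (auto elim: edge_adj)
  qed
  moreover have "finite ?P"
    by (rule finite_subset[of _ "{q..f} \<times> {q'..g}"]) (auto simp: adj_def)
  ultimately have "card M \<le> card ?P" by (rule surj_card_le[rotated])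
  also have "\<dots> \<le> card {1..m}"
  proof (rule card_inj_on_le[of "\<lambda>(a, b). charge a b"])
    show "inj_on (\<lambda>(a, b). charge a b) ?P"
    proof (rule inj_onI, clarify)
      fix a b a' b'
      assume ab: "adj a b" "{x a, y b} \<in> M" "adj a' b'" "{x a', y b'} \<in> M"
        and eq: "charge a b = charge a' b'"
      show "a = a' \<and> b = b'"
      proof (rule ccontr)
        assume "\<not> (a = a' \<and> b = b')"
        then have "a \<noteq> a' \<and> \<not> adj a b' \<and> \<not> adj a' b"
          using induced_matching_not_adj[OF M] ab by blast
        then have "charge a b \<noteq> charge a' b'"
          using charge_less[of a b a' b'] charge_less[of a' b' a b] ab
          by (metis less_irrefl linorder_neqE_nat)
        then show False using eq by contradiction
      qed
    qed
  qed (use precedes_le[OF charge_precedes] in auto)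
  finally show ?thesis by simp
qed

end

theorem theorem2p5:
  fixes V :: "'a set" and E :: "'a set set"
    and x y :: "nat \<Rightarrow> 'a" and q f q' g :: nat
  assumes "strongly_biconvex V E x q f y q' g"
    and "no_isolated_vertices V E"
  shows "maximum_induced_matching E (greedy_matching E x q f y q' g)"
proof -
  interpret strongly_biconvex_graph V E x y q f q' g
    using assms by unfold_locales
  show ?thesis
    unfolding maximum_induced_matching_def card_greedy
    using induced_matching_greedy card_induced_matching_le by blast
qed

end
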